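(* There exist two points $\tau_{1/2} > \log 3 > \tau_1 > 1$ such that the function $H\mapsto \mathsf{V}(H,t)$, $H\in[1/2,1]$, behaves as follows: (a) for any fixed $t\in(0,\tau_1]$, $\mathsf{V}(H,t)$ decreases in $H\in[1/2,1]$; (b) for any fixed $t\in(\tau_1,\log 3)$ there exists $H_t$ with $1/2<H_t<1$ such that $\mathsf{V}(H,t)$ decreases in $H\in[1/2,H_t]$, increases in $H\in[H_t,1]$, and $\mathsf{V}(1,t)<\mathsf{V}(1/2,t)$; (c) for $t=\log 3$ there exists $H_{\log 3}$ with $1/2<H_{\log 3}<1$ such that $\mathsf{V}(H,\log 3)$ decreases in $H\in[1/2,H_{\log 3}]$, increases in $H\in[H_{\log 3},1]$, and $\mathsf{V}(1/2,\log 3)=\mathsf{V}(1,\log 3)$; (d) for any fixed $t\in(\log 3,\tau_{1/2}]$ there exists $H_t\in[1/2,1)$ such that $\mathsf{V}(H,t)$ decreases in $H\in[1/2,H_t]$, increases in $H\in[H_t,1]$, and $\mathsf{V}(1/2,t)<\mathsf{V}(1,t)$; (e) for any fixed $t>\tau_{1/2}$, $\mathsf{V}(H,t)$ increases in $H\in[1/2,1]$.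
   Context: For $H\in(0,1)$, $B^H=\{B^H_t, t\ge 0\}$ is a fractional Brownian motion with Hurst index $H$: a zero-mean Gaussian process (with continuous paths) with covariance $\mathsf{E}B^H_tB^H_s=\frac12(t^{2H}+s^{2H}-|t-s|^{2H})$. Define the Wiener integral $X^H_t=\int_0^t e^s\,dB^H_s = e^tB^H_t-\int_0^t e^sB^H_s\,ds$, $t\ge 0$, and $\mathsf{V}(H,t)=\mathsf{E}(X^H_t)^2$. For $H=1$ the process is $X^1_t=\xi(e^t-1)$ with $\xi$ standard normal, so $\mathsf{V}(1,t)=(e^t-1)^2$. *)

theory Defs
  imports "HOL-Probability.Probability"
begin

text \<open>A real random variable is Gaussian if it is normally distributed, where the degenerate
  (zero variance) case is included; the library density covers only positive variances.\<close>

definition gaussian_rv :: "'a measure \<Rightarrow> ('a \<Rightarrow> real) \<Rightarrow> bool" where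
  "gaussian_rv M X \<longleftrightarrow> X \<in> borel_measurable M \<and>
     ((\<exists>\<mu> \<sigma>. 0 < \<sigma> \<and> distributed M lborel X (normal_density \<mu> \<sigma>)) \<or>
      (\<exists>\<mu>. AE \<omega> in M. X \<omega> = \<mu>))"

text \<open>A process with index set \<open>[0, \<infinity>)\<close> is Gaussian if all its finite linear combinations are;
  values at negative times are irrelevant.\<close>

definition gaussian_process :: "'a measure \<Rightarrow> (real \<Rightarrow> 'a \<Rightarrow> real) \<Rightarrow> bool" where
  "gaussian_process M B \<longleftrightarrow>
     (\<forall>I c. finite I \<longrightarrow> I \<subseteq> {0..} \<longrightarrow> gaussian_rv M (\<lambda>\<omega>. \<Sum>t\<in>I. c t * B t \<omega>))"

text \<open>Paths are continuous for every outcome, so that the integral along a path is a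
  measurable function of the outcome without completing \<open>M\<close>.\<close>

locale fractional_brownian_motion = prob_space M
  for M :: "'a measure" and H :: real and B :: "real \<Rightarrow> 'a \<Rightarrow> real" +
  assumes Hurst_index: "0 < H" "H < 1"
    and gaussian: "gaussian_process M B"
    and zero_mean: "\<And>t. 0 \<le> t \<Longrightarrow> expectation (B t) = 0"
    and covariance: "\<And>s t. 0 \<le> s \<Longrightarrow> 0 \<le> t \<Longrightarrow>
      expectation (\<lambda>\<omega>. B t \<omega> * B s \<omega>) =
        (t powr (2 * H) + s powr (2 * H) - \<bar>t - s\<bar> powr (2 * H)) / 2"
    and continuous_paths: "\<And>\<omega>. \<omega> \<in> space M \<Longrightarrow> continuous_on {0..} (\<lambda>t. B t \<omega>)"

text \<open>The Wiener integral of \<open>exp\<close> over \<open>[0, t]\<close> with respect to \<open>B\<close>, defined pathwise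
  by integration by parts.\<close>

definition wiener_integral_exp :: "(real \<Rightarrow> 'a \<Rightarrow> real) \<Rightarrow> real \<Rightarrow> 'a \<Rightarrow> real" where
  "wiener_integral_exp B t \<omega> =
     exp t * B t \<omega> - (LINT s:{0..t}|lborel. exp s * B s \<omega>)"

text \<open>The process \<open>B H\<close> drives the integral for \<open>H < 1\<close>, and the random variable \<open>\<xi>\<close>
  for \<open>H = 1\<close>.\<close>

definition X_process ::
  "(real \<Rightarrow> real \<Rightarrow> 'a \<Rightarrow> real) \<Rightarrow> ('a \<Rightarrow> real) \<Rightarrow> real \<Rightarrow> real \<Rightarrow> 'a \<Rightarrow> real" where
  "X_process B \<xi> H t \<omega> =
     (if H = 1 then \<xi> \<omega> * (exp t - 1) else wiener_integral_exp (B H) t \<omega>)"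

text \<open>Each Hurst index may have its own probability space \<open>M H\<close>.\<close>

definition second_moment ::
  "(real \<Rightarrow> 'a measure) \<Rightarrow> (real \<Rightarrow> real \<Rightarrow> 'a \<Rightarrow> real) \<Rightarrow> ('a \<Rightarrow> real) \<Rightarrow> real \<Rightarrow> real \<Rightarrow> real" where
  "second_moment M B \<xi> H t = (LINT \<omega>|M H. (X_process B \<xi> H t \<omega>)\<^sup>2)"

end

theory Submission
  imports Defs "HOL-Real_Asymp.Real_Asymp"
begin

text \<open>
  The covariance and Fubini's theorem give a closed form: with \<open>p = 2 * H\<close>,
  \<open>V H t = exp t * (t powr p + (\<integral>u = 0..t. u powr p * sinh (t - u)))\<close>,
  and the same formula holds at \<open>H = 1\<close>. The bracket is the value of a positive linear operator
  \<open>\<phi> \<mapsto> sinh_transform \<phi> t\<close> at \<open>\<phi> u = u powr p\<close>. Since \<open>u powr p\<close> is strictly convex in \<open>p\<close> for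
  \<open>0 < u \<noteq> 1\<close>, so is \<open>V H t\<close> in \<open>H\<close>, and its derivative is a positive multiple of
  \<open>slope p t = sinh_transform (\<lambda>u. u powr p * ln u) t\<close>. A strictly convex function decreases on an
  interval if the slope at the right end is at most 0, increases if the slope at the left end is at
  least 0, and otherwise first decreases and then increases. So everything rests on the signs of
  \<open>slope 2 t\<close> and \<open>slope 1 t\<close> as functions of \<open>t\<close>.

  For fixed \<open>p\<close> the sign of \<open>slope p t\<close> changes only once, from negative to positive: it is negative
  for \<open>t \<le> 1\<close>, where the logarithm is negative, and for \<open>t > 1\<close> the function \<open>g = slope p\<close> solves
  \<open>g'' - g = \<phi>'' \<ge> 0\<close> with \<open>\<phi> u = u powr p * ln u\<close>, so that the Wronskian of \<open>g\<close> and \<open>sinh (t - 1)\<close>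
  is positive and \<open>g t / sinh (t - 1)\<close> increases (\<open>sinh_transform_single_crossing\<close>). The two
  thresholds \<open>\<tau>\<^sub>1\<close> and \<open>\<tau>\<^sub>h\<close> are the zeros of \<open>slope 2\<close> and of \<open>slope 1\<close>.

  They are located without numerical work. From \<open>V 1 t - V (1/2) t = (exp t - 1) * (exp t - 3) / 2\<close>
  the two end values agree at \<open>t = ln 3\<close>, and by strict convexity \<open>slope 1 (ln 3) < 0 < slope 2 (ln 3)\<close>;
  this places \<open>\<tau>\<^sub>1\<close> in \<open>(1, ln 3)\<close> and \<open>\<tau>\<^sub>h\<close> above \<open>ln 3\<close>. That \<open>slope 1\<close> does become positive follows from
  \<open>u * ln u \<ge> u - 1\<close> at \<open>t = exp 1\<close> (\<open>slope_1_exp_1_pos\<close>).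
\<close>

section \<open>Integrals of square integrable processes\<close>

text \<open>The Cauchy-Schwarz inequality against a constant: integrate \<open>(f s - c)\<^sup>2 \<ge> 0\<close> and take for \<open>c\<close>
  the mean value of \<open>f\<close>.\<close>

lemma square_integral_le:
  fixes f :: "'b \<Rightarrow> real"
  assumes "finite_measure N" and f: "integrable N f" and f2: "integrable N (\<lambda>s. (f s)\<^sup>2)"
  shows "(\<integral>s. f s \<partial>N)\<^sup>2 \<le> measure N (space N) * (\<integral>s. (f s)\<^sup>2 \<partial>N)"
proof -
  interpret finite_measure N by fact
  let ?m = "measure N (space N)" and ?I = "\<integral>s. f s \<partial>N" and ?J = "\<integral>s. (f s)\<^sup>2 \<partial>N"
  have expand: "(\<integral>s. (f s - c)\<^sup>2 \<partial>N) = ?J - 2 * c * ?I + c\<^sup>2 * ?m" for c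
    by (simp add: power2_diff f f2 Bochner_Integration.integral_diff mult.commute mult.left_commute)
  show ?thesis
  proof (cases "?m = 0")
    case True
    have "0 \<le> ?J - 2 * c * ?I" for c using expand[of c] Bochner_Integration.integral_nonneg[of N "\<lambda>s. (f s - c)\<^sup>2"] True by simp
    \<comment> \<open>On a null space the inequality is linear in \<open>c\<close>, and this choice of \<open>c\<close> makes the right-hand
    side equal to -1 unless the integral of \<open>f\<close> vanishes.\<close>
    from this[of "(?J + 1) / (2 * ?I)"] True show ?thesis by (cases "?I = 0") auto
  next
    case False
    then have m: "0 < ?m" by (simp add: zero_less_measure_iff measure_eq_0_null_sets order_le_less)
    have "0 \<le> ?J - 2 * (?I / ?m) * ?I + (?I / ?m)\<^sup>2 * ?m"
      unfolding expand[symmetric] by simp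
    then show ?thesis using m by (simp add: field_simps power2_eq_square)
  qed
qed

text \<open>Bounded second moments over a finite measure make every integrability condition of Fubini's
  theorem available, so that expectation and integration in \<open>s\<close> can be exchanged.\<close>

locale square_integrable_process = prob_space M + N: finite_measure N
  for M :: "'a measure" and N :: "'b measure" +
  fixes Y :: "'b \<Rightarrow> 'a \<Rightarrow> real" and c :: real
  assumes measurable_process [measurable]: "case_prod Y \<in> borel_measurable (N \<Otimes>\<^sub>M M)"
    and integrable_square: "\<And>s. s \<in> space N \<Longrightarrow> integrable M (\<lambda>\<omega>. (Y s \<omega>)\<^sup>2)"
    and square_bound: "\<And>s. s \<in> space N \<Longrightarrow> expectation (\<lambda>\<omega>. (Y s \<omega>)\<^sup>2) \<le> c"
begin

sublocale NM: pair_sigma_finite N M ..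

lemma integrable_square_pair: "integrable (N \<Otimes>\<^sub>M M) (\<lambda>(s, \<omega>). (Y s \<omega>)\<^sup>2)"
proof (rule NM.Fubini_integrable)
  show "integrable N (\<lambda>s. \<integral>\<omega>. norm (case (s, \<omega>) of (s, \<omega>) \<Rightarrow> (Y s \<omega>)\<^sup>2) \<partial>M)"
    by (rule N.integrable_const_bound[where B = c]) (use square_bound in \<open>auto simp: integral_nonneg\<close>)
qed (auto simp: integrable_square)

lemma integrable_product_pair:
  assumes [measurable]: "Z \<in> borel_measurable M" and Z: "integrable M (\<lambda>\<omega>. (Z \<omega>)\<^sup>2)"
  shows "integrable (N \<Otimes>\<^sub>M M) (\<lambda>(s, \<omega>). Y s \<omega> * Z \<omega>)"
proof (rule Bochner_Integration.integrable_bound)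
  have "integrable (N \<Otimes>\<^sub>M M) (\<lambda>(s, \<omega>). (Z \<omega>)\<^sup>2)"
    by (rule NM.Fubini_integrable) (auto simp: Z)
  with integrable_square_pair
  show "integrable (N \<Otimes>\<^sub>M M) (\<lambda>x. (case x of (s, \<omega>) \<Rightarrow> (Y s \<omega>)\<^sup>2) + (case x of (s, \<omega>) \<Rightarrow> (Z \<omega>)\<^sup>2))"
    by (rule Bochner_Integration.integrable_add)
next
  have "\<bar>a * b\<bar> \<le> a\<^sup>2 + b\<^sup>2" for a b :: real
  proof -
    have "0 \<le> \<bar>a\<bar> * \<bar>b\<bar>" "2 * (\<bar>a\<bar> * \<bar>b\<bar>) \<le> a\<^sup>2 + b\<^sup>2"
      using sum_squares_bound[of "\<bar>a\<bar>" "\<bar>b\<bar>"] by auto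
    then show ?thesis unfolding abs_mult by linarith
  qed
  then show "AE x in N \<Otimes>\<^sub>M M. norm (case x of (s, \<omega>) \<Rightarrow> Y s \<omega> * Z \<omega>) \<le>
      norm ((case x of (s, \<omega>) \<Rightarrow> (Y s \<omega>)\<^sup>2) + (case x of (s, \<omega>) \<Rightarrow> (Z \<omega>)\<^sup>2))"
    by (auto simp: case_prod_beta)
qed measurable

lemma measurable_integral [measurable]: "(\<lambda>\<omega>. \<integral>s. Y s \<omega> \<partial>N) \<in> borel_measurable M"
  by measurable

text \<open>The integrated process is itself square integrable. Hence it may serve as the factor \<open>Z\<close> in
  \<open>expectation_integral_mult\<close>, which is how its own second moment becomes a double integral of
  the covariance.\<close>

lemma integrable_square_integral: "integrable M (\<lambda>\<omega>. (\<integral>s. Y s \<omega> \<partial>N)\<^sup>2)"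
proof (rule Bochner_Integration.integrable_bound)
  show "integrable M (\<lambda>\<omega>. measure N (space N) * (\<integral>s. (Y s \<omega>)\<^sup>2 \<partial>N))"
    by (intro integrable_mult_right NM.integrable_snd integrable_square_pair)
  have "AE \<omega> in M. integrable N (\<lambda>s. (Y s \<omega>)\<^sup>2)"
    by (intro NM.AE_integrable_snd integrable_square_pair)
  moreover have "AE \<omega> in M. integrable N (\<lambda>s. Y s \<omega>)"
    using NM.AE_integrable_snd[OF integrable_product_pair[of "\<lambda>_. 1"]] by simp
  ultimately show "AE \<omega> in M. norm ((\<integral>s. Y s \<omega> \<partial>N)\<^sup>2) \<le> norm (measure N (space N) * (\<integral>s. (Y s \<omega>)\<^sup>2 \<partial>N))"
  proof eventually_elim
    case (elim \<omega>)
    then show ?case using square_integral_le[OF N.finite_measure_axioms, of "\<lambda>s. Y s \<omega>"]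
      by (auto simp: integral_nonneg)
  qed
qed measurable

lemma integrable_integral_mult:
  assumes "Z \<in> borel_measurable M" and "integrable M (\<lambda>\<omega>. (Z \<omega>)\<^sup>2)"
  shows "integrable M (\<lambda>\<omega>. (\<integral>s. Y s \<omega> \<partial>N) * Z \<omega>)"
  using NM.integrable_snd[OF integrable_product_pair[OF assms]] by simp

lemma expectation_integral_mult:
  assumes [measurable]: "Z \<in> borel_measurable M" and "integrable M (\<lambda>\<omega>. (Z \<omega>)\<^sup>2)"
  shows "expectation (\<lambda>\<omega>. (\<integral>s. Y s \<omega> \<partial>N) * Z \<omega>) = (\<integral>s. expectation (\<lambda>\<omega>. Y s \<omega> * Z \<omega>) \<partial>N)"
  using NM.Fubini_integral[OF integrable_product_pair[OF assms]] by simp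

lemma expectation_square_integral:
  "expectation (\<lambda>\<omega>. (\<integral>s. Y s \<omega> \<partial>N)\<^sup>2) = (\<integral>s. \<integral>u. expectation (\<lambda>\<omega>. Y s \<omega> * Y u \<omega>) \<partial>N \<partial>N)"
proof -
  have "expectation (\<lambda>\<omega>. (\<integral>s. Y s \<omega> \<partial>N)\<^sup>2) =
      (\<integral>s. expectation (\<lambda>\<omega>. Y s \<omega> * (\<integral>u. Y u \<omega> \<partial>N)) \<partial>N)"
    unfolding power2_eq_square
    by (rule expectation_integral_mult[OF measurable_integral integrable_square_integral])
  also have "\<dots> = (\<integral>s. \<integral>u. expectation (\<lambda>\<omega>. Y s \<omega> * Y u \<omega>) \<partial>N \<partial>N)"
  proof (rule Bochner_Integration.integral_cong[OF refl])
    fix s assume s: "s \<in> space N"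
    have "Y s \<in> borel_measurable M" using measurable_process s by measurable
    from expectation_integral_mult[OF this integrable_square[OF s]]
    show "expectation (\<lambda>\<omega>. Y s \<omega> * (\<integral>u. Y u \<omega> \<partial>N)) = (\<integral>u. expectation (\<lambda>\<omega>. Y s \<omega> * Y u \<omega>) \<partial>N)"
      by (simp add: mult.commute)
  qed
  finally show ?thesis .
qed

end

text \<open>Joint measurability comes from continuity of the paths: rounding the time down to the grid of
  mesh \<open>1 / Suc n\<close> gives a jointly measurable process with countably many distinct time points, and
  these processes converge pointwise. Clamping negative times to 0 extends the process to all of
  the real line.\<close>

lemma measurable_continuous_paths:
  fixes Y :: "real \<Rightarrow> 'a \<Rightarrow> real"
  assumes [measurable]: "\<And>s. 0 \<le> s \<Longrightarrow> Y s \<in> borel_measurable M"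
    and cont: "\<And>\<omega>. \<omega> \<in> space M \<Longrightarrow> continuous_on {0..} (\<lambda>s. Y s \<omega>)"
  shows "(\<lambda>(s, \<omega>). Y (max 0 s) \<omega>) \<in> borel_measurable (borel \<Otimes>\<^sub>M M)"
proof -
  define r :: "nat \<Rightarrow> real \<Rightarrow> real" where "r n s = real (nat \<lfloor>real (Suc n) * s\<rfloor>) / real (Suc n)" for n s
  have r: "(\<lambda>n. r n s) \<longlonglongrightarrow> max 0 s" for s
  proof (cases "0 \<le> s")
    case True
    show ?thesis
    proof (rule tendsto_sandwich)
      show "\<forall>\<^sub>F n in sequentially. s - 1 / real (Suc n) \<le> r n s"
      proof (intro always_eventually allI)
        fix n
        have "real (Suc n) * s - 1 \<le> real (nat \<lfloor>real (Suc n) * s\<rfloor>)" by linarith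
        then have "(real (Suc n) * s - 1) / real (Suc n) \<le> r n s"
          unfolding r_def by (rule divide_right_mono) simp
        then show "s - 1 / real (Suc n) \<le> r n s" by (simp add: diff_divide_distrib)
      qed
      show "\<forall>\<^sub>F n in sequentially. r n s \<le> s"
        using True by (intro always_eventually allI) (simp add: r_def field_simps)
      show "(\<lambda>n. s - 1 / real (Suc n)) \<longlonglongrightarrow> max 0 s"
        using True LIMSEQ_inverse_real_of_nat tendsto_diff[OF tendsto_const[of s]]
        by (fastforce simp: inverse_eq_divide)
    qed (use True in auto)
  next
    case False
    have "r n s = 0" for n
    proof -
      have "real (Suc n) * s \<le> 0" using False by (intro mult_nonneg_nonpos) auto
      then have "\<lfloor>real (Suc n) * s\<rfloor> \<le> 0" by linarith
      then show ?thesis by (simp add: r_def)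
    qed
    then show ?thesis using False by simp
  qed
  show ?thesis
  proof (rule borel_measurable_LIMSEQ_real)
    show "(\<lambda>n. (\<lambda>(s, \<omega>). Y (r n s) \<omega>) z) \<longlonglongrightarrow> (\<lambda>(s, \<omega>). Y (max 0 s) \<omega>) z"
      if z_space: "z \<in> space (borel \<Otimes>\<^sub>M M)" for z
    proof -
      obtain s \<omega> where z: "z = (s, \<omega>)" and "\<omega> \<in> space M" using z_space by (cases z) (auto simp: space_pair_measure)
      have "(\<lambda>n. Y (r n s) \<omega>) \<longlonglongrightarrow> Y (max 0 s) \<omega>"
        using cont[OF \<open>\<omega> \<in> space M\<close>] r[of s] by (rule continuous_on_tendsto_compose) (auto simp: r_def)
      then show ?thesis by (simp add: z)
    qed
    show "(\<lambda>(s, \<omega>). Y (r n s) \<omega>) \<in> borel_measurable (borel \<Otimes>\<^sub>M M)" for n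
    proof -
      have "(\<lambda>z. (\<lambda>k z. Y (real k / real (Suc n)) (snd z)) (nat \<lfloor>real (Suc n) * fst z\<rfloor>) z)
          \<in> borel_measurable (borel \<Otimes>\<^sub>M M)"
        by (rule measurable_compose_countable) measurable
      then show ?thesis by (simp add: r_def case_prod_beta)
    qed
  qed
qed

lemma gaussian_rv_integrable_square:
  assumes "prob_space M" "gaussian_rv M X"
  shows "X \<in> borel_measurable M" "integrable M (\<lambda>\<omega>. (X \<omega>)\<^sup>2)"
proof -
  interpret prob_space M by fact
  show X[measurable]: "X \<in> borel_measurable M" using assms(2) by (simp add: gaussian_rv_def)
  consider (normal) \<mu> \<sigma> where "0 < \<sigma>" "distributed M lborel X (normal_density \<mu> \<sigma>)"
    | (const) \<mu> where "AE \<omega> in M. X \<omega> = \<mu>"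
    using assms(2) unfolding gaussian_rv_def by blast
  then show "integrable M (\<lambda>\<omega>. (X \<omega>)\<^sup>2)"
  proof cases
    case normal
    \<comment> \<open>The expansion of \<open>x\<^sup>2\<close> about the mean \<open>\<mu>\<close>.\<close>
    have "integrable lborel (\<lambda>x. normal_density \<mu> \<sigma> x * (x - \<mu>)^2 + 2 * \<mu> * (normal_density \<mu> \<sigma> x * (x - \<mu>)^1)
        + \<mu>\<^sup>2 * normal_density \<mu> \<sigma> x)"
      using normal(1) by (intro Bochner_Integration.integrable_add integrable_mult_right integrable_normal_moment) auto
    then have "integrable lborel (\<lambda>x. normal_density \<mu> \<sigma> x * x\<^sup>2)"
      by (rule back_subst[of "integrable lborel"]) (auto simp: fun_eq_iff power2_eq_square algebra_simps)
    then show ?thesis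
      using distributed_integrable[OF normal(2), of "\<lambda>x. x\<^sup>2"] by simp
  next
    case const
    then have "integrable M (\<lambda>\<omega>. (X \<omega>)\<^sup>2) \<longleftrightarrow> integrable M (\<lambda>\<omega>. \<mu>\<^sup>2)"
      by (intro integrable_cong_AE) auto
    then show ?thesis by simp
  qed
qed

section \<open>Convolution with the hyperbolic sine\<close>

text \<open>The value at \<open>t\<close> of the solution \<open>g\<close> of \<open>g'' - g = \<phi>''\<close> whose difference to \<open>\<phi>\<close> vanishes at 0
  together with its derivative. The map \<open>\<phi> \<mapsto> sinh_transform \<phi> t\<close> is linear and positive.\<close>

definition sinh_transform :: "(real \<Rightarrow> real) \<Rightarrow> real \<Rightarrow> real" where
  "sinh_transform \<phi> t = \<phi> t + integral {0..t} (\<lambda>u. \<phi> u * sinh (t - u))"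

lemma integral_mult_exp_has_derivative:
  fixes \<phi> :: "real \<Rightarrow> real"
  assumes "continuous_on {0..} \<phi>" "0 < t"
  shows "((\<lambda>x. integral {0..x} (\<lambda>u. \<phi> u * exp (c * u))) has_real_derivative \<phi> t * exp (c * t)) (at t)"
proof -
  have "continuous_on {0..t+1} (\<lambda>u. \<phi> u * exp (c * u))"
    by (intro continuous_intros continuous_on_subset[OF assms(1)]) auto
  from integral_has_real_derivative[OF this, of t] assms(2)
  have "((\<lambda>x. integral {0..x} (\<lambda>u. \<phi> u * exp (c * u))) has_real_derivative \<phi> t * exp (c * t))
    (at t within {0..t+1})" by auto
  moreover have "at t within {0..t+1} = at t"
    using assms(2) by (intro at_within_interior) (auto simp: interior_atLeastAtMost_real)
  ultimately show ?thesis by simp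
qed

text \<open>Here \<open>t\<close> occurs both as a limit of integration and in the integrand; the addition theorem pulls
  it out of the integrand, so that the fundamental theorem of calculus applies. Exponents are written \<open>c * u\<close>
  with \<open>c = -1\<close> and \<open>c = 1\<close> so that one lemma treats both.\<close>

lemma integral_mult_hyperbolic_conv_exp:
  fixes \<phi> :: "real \<Rightarrow> real"
  assumes "continuous_on {0..} \<phi>"
  shows "integral {0..t} (\<lambda>u. \<phi> u * sinh (t - u)) =
      (exp t * integral {0..t} (\<lambda>u. \<phi> u * exp (-1 * u)) -
       exp (- t) * integral {0..t} (\<lambda>u. \<phi> u * exp (1 * u))) / 2" (is ?S)
    and "integral {0..t} (\<lambda>u. \<phi> u * cosh (t - u)) =
      (exp t * integral {0..t} (\<lambda>u. \<phi> u * exp (-1 * u)) +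
       exp (- t) * integral {0..t} (\<lambda>u. \<phi> u * exp (1 * u))) / 2" (is ?C)
proof -
  have int: "((\<lambda>u. \<phi> u * exp (c * u)) has_integral integral {0..t} (\<lambda>u. \<phi> u * exp (c * u))) {0..t}" for c
    by (intro integrable_integral integrable_continuous_interval continuous_intros
        continuous_on_subset[OF assms]) auto
  have "((\<lambda>u. (exp t * (\<phi> u * exp (-1 * u)) - exp (-t) * (\<phi> u * exp (1 * u))) / 2) has_integral
      (exp t * integral {0..t} (\<lambda>u. \<phi> u * exp (-1 * u)) -
       exp (- t) * integral {0..t} (\<lambda>u. \<phi> u * exp (1 * u))) / 2) {0..t}"
    by (intro has_integral_divide has_integral_diff has_integral_mult_right int)
  then show ?S
    by (intro integral_unique, elim has_integral_eq[rotated])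
       (simp add: sinh_field_def exp_diff exp_minus field_simps)
  have "((\<lambda>u. (exp t * (\<phi> u * exp (-1 * u)) + exp (-t) * (\<phi> u * exp (1 * u))) / 2) has_integral
      (exp t * integral {0..t} (\<lambda>u. \<phi> u * exp (-1 * u)) +
       exp (- t) * integral {0..t} (\<lambda>u. \<phi> u * exp (1 * u))) / 2) {0..t}"
    by (intro has_integral_divide has_integral_add has_integral_mult_right int)
  then show ?C
    by (intro integral_unique, elim has_integral_eq[rotated])
       (simp add: cosh_field_def exp_diff exp_minus field_simps)
qed

lemma integral_mult_hyperbolic_has_derivative:
  fixes \<phi> :: "real \<Rightarrow> real"
  assumes "continuous_on {0..} \<phi>" "0 < t"
  shows "((\<lambda>t. integral {0..t} (\<lambda>u. \<phi> u * sinh (t - u))) has_real_derivative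
      integral {0..t} (\<lambda>u. \<phi> u * cosh (t - u))) (at t)"
    and "((\<lambda>t. integral {0..t} (\<lambda>u. \<phi> u * cosh (t - u))) has_real_derivative
      \<phi> t + integral {0..t} (\<lambda>u. \<phi> u * sinh (t - u))) (at t)"
proof -
  let ?A = "\<lambda>x. integral {0..x} (\<lambda>u. \<phi> u * exp (-1 * u))"
    and ?C = "\<lambda>x. integral {0..x} (\<lambda>u. \<phi> u * exp (1 * u))"
  note A = integral_mult_exp_has_derivative[OF assms, of "-1"]
    and C = integral_mult_exp_has_derivative[OF assms, of 1]
  have cancel: "exp t * exp (-1 * t) = 1" "exp (- t) * exp (1 * t) = 1"
    by (simp_all flip: exp_add)
  have E: "((\<lambda>x. exp (- x)) has_real_derivative - exp (- t)) (at t)"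
    by (auto intro!: derivative_eq_intros)
  note EA = DERIV_mult[OF DERIV_exp A] and EC = DERIV_mult[OF E C]
  show "((\<lambda>t. integral {0..t} (\<lambda>u. \<phi> u * sinh (t - u))) has_real_derivative
      integral {0..t} (\<lambda>u. \<phi> u * cosh (t - u))) (at t)"
    unfolding integral_mult_hyperbolic_conv_exp[OF assms(1)]
    by (rule DERIV_cong[OF DERIV_cdivide[OF DERIV_diff[OF EA EC]]]) (use cancel in algebra)
  show "((\<lambda>t. integral {0..t} (\<lambda>u. \<phi> u * cosh (t - u))) has_real_derivative
      \<phi> t + integral {0..t} (\<lambda>u. \<phi> u * sinh (t - u))) (at t)"
    unfolding integral_mult_hyperbolic_conv_exp[OF assms(1)]
    by (rule DERIV_cong[OF DERIV_cdivide[OF DERIV_add[OF EA EC]]]) (use cancel in algebra)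
qed

text \<open>A Sturm-type comparison. The function \<open>K\<close> below is the Wronskian of \<open>g\<close> and the solution \<open>sinh (x - a)\<close> of the
  homogeneous equation; \<open>g'' - g = \<phi>''\<close> gives \<open>K' x = \<phi>'' x * sinh (x - a) \<ge> 0\<close>, and \<open>K a = - g a > 0\<close>. So
  \<open>g x / sinh (x - a)\<close> is strictly increasing beyond \<open>a\<close>.\<close>

lemma sinh_transform_single_crossing:
  fixes \<phi> \<phi>' \<phi>'' :: "real \<Rightarrow> real"
  assumes cont: "continuous_on {0..} \<phi>" and "0 < a"
    and \<phi>': "\<And>t. a \<le> t \<Longrightarrow> (\<phi> has_real_derivative \<phi>' t) (at t)"
    and \<phi>'': "\<And>t. a \<le> t \<Longrightarrow> (\<phi>' has_real_derivative \<phi>'' t) (at t)"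
    and convex: "\<And>t. a \<le> t \<Longrightarrow> 0 \<le> \<phi>'' t"
    and neg: "sinh_transform \<phi> a < 0"
    and nonneg: "0 \<le> sinh_transform \<phi> s" and "a < s" "s < t"
  shows "0 < sinh_transform \<phi> t"
proof -
  define g where "g = sinh_transform \<phi>"
  define g' where "g' x = \<phi>' x + integral {0..x} (\<lambda>u. \<phi> u * cosh (x - u))" for x
  define K where "K x = g' x * sinh (x - a) - g x * cosh (x - a)" for x
  have g: "(g has_real_derivative g' x) (at x)" if "a \<le> x" for x
    unfolding g_def g'_def sinh_transform_def[abs_def] using that \<open>0 < a\<close>
    by (intro DERIV_add \<phi>' integral_mult_hyperbolic_has_derivative cont) auto
  have g': "(g' has_real_derivative \<phi>'' x + g x) (at x)" if "a \<le> x" for x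
    unfolding g_def g'_def[abs_def] sinh_transform_def using that \<open>0 < a\<close>
    by (intro DERIV_add \<phi>'' integral_mult_hyperbolic_has_derivative cont) auto
  have K: "(K has_real_derivative \<phi>'' x * sinh (x - a)) (at x)" if "a \<le> x" for x
    unfolding K_def[abs_def]
    by (rule derivative_eq_intros g g' refl that)+ (simp add: algebra_simps)
  have K_pos: "0 < K x" if "a \<le> x" for x
  proof -
    have "K a \<le> K x"
      by (rule DERIV_nonneg_imp_nondecreasing[OF that]) (use K convex in force)
    then show ?thesis using neg by (simp add: K_def g_def)
  qed
  have "g s / sinh (s - a) < g t / sinh (t - a)"
  proof (rule DERIV_pos_imp_increasing[OF \<open>s < t\<close>])
    fix x assume "s \<le> x" "x \<le> t"
    then have x: "a < x" using \<open>a < s\<close> by simp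
    have "((\<lambda>x. g x / sinh (x - a)) has_real_derivative K x / (sinh (x - a))\<^sup>2) (at x)"
      using x by - ((rule derivative_eq_intros g refl | simp)+, simp add: K_def power2_eq_square)
    then show "\<exists>y. ((\<lambda>x. g x / sinh (x - a)) has_real_derivative y) (at x) \<and> 0 < y"
      using K_pos[of x] x by (intro exI[of _ "K x / (sinh (x - a))\<^sup>2"]) auto
  qed
  moreover have "0 \<le> g s / sinh (s - a)" using nonneg \<open>a < s\<close> by (simp add: g_def)
  ultimately have "0 < g t / sinh (t - a)" by simp
  then show ?thesis using \<open>a < s\<close> \<open>s < t\<close> by (simp add: g_def zero_less_divide_iff)
qed

lemma continuous_on_sinh_transform:
  assumes cont: "continuous_on {0..} \<phi>"
  shows "continuous_on {0<..} (sinh_transform \<phi>)"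
proof -
  have "continuous_on {0<..} (\<lambda>t. integral {0..t} (\<lambda>u. \<phi> u * sinh (t - u)))"
    using integral_mult_hyperbolic_has_derivative(1)[OF cont]
    by (intro continuous_at_imp_continuous_on ballI) (auto intro: DERIV_isCont)
  then show ?thesis
    unfolding sinh_transform_def[abs_def]
    by (intro continuous_on_add continuous_on_subset[OF cont]) auto
qed

lemma integrable_mult_sinh:
  fixes \<phi> :: "real \<Rightarrow> real"
  assumes "continuous_on {0..t} \<phi>"
  shows "(\<lambda>u. \<phi> u * sinh (t - u)) integrable_on {0..t}"
  by (intro integrable_continuous_interval continuous_intros assms)

lemma sinh_transform_diff:
  assumes "continuous_on {0..t} \<phi>" "continuous_on {0..t} \<psi>"
  shows "sinh_transform (\<lambda>u. \<phi> u - \<psi> u) t = sinh_transform \<phi> t - sinh_transform \<psi> t"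
  using integral_diff[OF integrable_mult_sinh[OF assms(1)] integrable_mult_sinh[OF assms(2)]]
  by (simp add: sinh_transform_def left_diff_distrib)

lemma sinh_transform_cmult: "sinh_transform (\<lambda>u. c * \<phi> u) t = c * sinh_transform \<phi> t"
  by (simp add: sinh_transform_def mult.assoc distrib_left)

lemma sinh_transform_ge:
  assumes "continuous_on {0..t} \<phi>" "\<And>u. u \<in> {0..t} \<Longrightarrow> 0 \<le> \<phi> u"
  shows "\<phi> t \<le> sinh_transform \<phi> t"
  using assms by (auto simp: sinh_transform_def intro!: integral_nonneg integrable_mult_sinh)

lemma sinh_transform_pos:
  assumes cont: "continuous_on {0..t} \<phi>" and nonneg: "\<And>u. u \<in> {0..t} \<Longrightarrow> 0 \<le> \<phi> u"
    and x: "0 \<le> x" "x < t" "0 < \<phi> x"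
  shows "0 < sinh_transform \<phi> t"
proof -
  have "integral {0..t} (\<lambda>u. \<phi> u * sinh (t - u)) \<noteq> 0"
  proof
    assume "integral {0..t} (\<lambda>u. \<phi> u * sinh (t - u)) = 0"
    moreover have "continuous_on {0..t} (\<lambda>u. \<phi> u * sinh (t - u))"
      by (intro continuous_intros cont)
    ultimately have "\<forall>u\<in>{0..t}. \<phi> u * sinh (t - u) = 0"
      using nonneg x by (subst (asm) integral_eq_0_iff) auto
    then show False using x by force
  qed
  moreover have "0 \<le> integral {0..t} (\<lambda>u. \<phi> u * sinh (t - u))"
    using nonneg by (auto intro!: integral_nonneg integrable_mult_sinh cont)
  moreover have "0 \<le> \<phi> t" using nonneg x by auto
  ultimately show ?thesis by (simp add: sinh_transform_def)
qed

section \<open>The second moment of the Wiener integral\<close>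

lemma continuous_on_powr_base:
  assumes "0 < p" shows "continuous_on {0..} (\<lambda>u::real. u powr p)"
  using assms by (intro continuous_on_powr' continuous_intros) auto

lemma has_integral_reverse:
  fixes f :: "real \<Rightarrow> real"
  assumes "(f has_integral i) {0..t}"
  shows "((\<lambda>s. f (t - s)) has_integral i) {0..t}"
proof -
  have "((\<lambda>s. f (- s)) has_integral i) {- t..- 0}" using assms by (simp only: has_integral_reflect_real)
  from has_integral_shift_real_ivl[OF this, of "- t"] show ?thesis by simp
qed

lemma LINT_Icc_eq_of_has_integral:
  fixes f :: "real \<Rightarrow> real"
  assumes "continuous_on {0..t} f" "(f has_integral i) {0..t}"
  shows "(LINT s:{0..t}|lborel. f s) = i"
  using set_borel_integral_eq_integral(2)[OF borel_integrable_atLeastAtMost'[OF assms(1)]]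
    integral_unique[OF assms(2)] by simp

text \<open>All integrals in the second moment reduce to the cases \<open>c = 1\<close> and \<open>c = -1\<close>.\<close>

definition exp_moment :: "real \<Rightarrow> real \<Rightarrow> real \<Rightarrow> real" where
  "exp_moment p c t = integral {0..t} (\<lambda>u. u powr p * exp (c * u))"

lemma exp_moment_has_integral:
  assumes "0 < p" shows "((\<lambda>u. u powr p * exp (c * u)) has_integral exp_moment p c t) {0..t}"
  unfolding exp_moment_def
  by (intro integrable_integral integrable_continuous_interval continuous_intros
      continuous_on_subset[OF continuous_on_powr_base[OF assms]]) auto

lemma exp_moment_has_derivative:
  assumes "0 < p" "s \<in> {0..t}"
  shows "(exp_moment p c has_real_derivative s powr p * exp (c * s)) (at s within {0..t})"
  unfolding exp_moment_def[abs_def]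
  by (intro integral_has_real_derivative continuous_intros assms
      continuous_on_subset[OF continuous_on_powr_base[OF assms(1)]]) auto

lemma continuous_on_exp_moment:
  assumes "0 < p" shows "continuous_on {0..t} (exp_moment p c)"
  by (rule DERIV_continuous_on[OF exp_moment_has_derivative[OF assms]])

lemma exp_moment_0 [simp]: "exp_moment p c 0 = 0"
  by (simp add: exp_moment_def)

lemma continuous_on_abs_powr [continuous_intros]:
  fixes f :: "real \<Rightarrow> real"
  assumes "0 < p" "continuous_on S f"
  shows "continuous_on S (\<lambda>x. \<bar>f x\<bar> powr p)"
  using assms by (intro continuous_on_powr' continuous_intros) auto

text \<open>Split at \<open>u = s\<close> and substitute \<open>v = \<bar>s - u\<bar>\<close> on either side.\<close>

lemma has_integral_exp_mult_abs_diff_powr: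
  assumes "0 < p" and s: "s \<in> {0..t}"
  shows "((\<lambda>u. exp u * \<bar>s - u\<bar> powr p) has_integral
    exp s * (exp_moment p (- 1) s + exp_moment p 1 (t - s))) {0..t}"
proof -
  have "((\<lambda>u. exp s * ((s - u) powr p * exp (- 1 * (s - u)))) has_integral exp s * exp_moment p (- 1) s) {0..s}"
    by (intro has_integral_mult_right has_integral_reverse[where f = "\<lambda>u. u powr p * exp (- 1 * u)"]
        exp_moment_has_integral assms)
  then have left: "((\<lambda>u. exp u * \<bar>s - u\<bar> powr p) has_integral exp s * exp_moment p (- 1) s) {0..s}"
    by (rule has_integral_eq[rotated]) (simp add: exp_diff)
  have "((\<lambda>u. exp s * ((u - s) powr p * exp (1 * (u - s)))) has_integral exp s * exp_moment p 1 (t - s)) {s..t}"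
    using has_integral_shift_real_ivl[OF exp_moment_has_integral[OF assms(1), of 1 "t - s"], of "- s"]
    by (intro has_integral_mult_right) simp
  then have right: "((\<lambda>u. exp u * \<bar>s - u\<bar> powr p) has_integral exp s * exp_moment p 1 (t - s)) {s..t}"
    by (rule has_integral_eq[rotated]) (simp add: exp_diff abs_minus_commute)
  show ?thesis
    unfolding distrib_left using s by (intro has_integral_combine[OF _ _ left right]) auto
qed

lemma has_integral_exp:
  assumes "0 \<le> t" shows "((\<lambda>u. exp u :: real) has_integral exp t - 1) {0..t}"
proof -
  have "(exp has_integral exp t - exp (0::real)) {0..t}"
    by (rule fundamental_theorem_of_calculus[OF assms])
       (auto simp flip: has_real_derivative_iff_has_vector_derivative
         intro: DERIV_exp has_field_derivative_at_within)
  then show ?thesis by simp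
qed

text \<open>The covariance of fractional Brownian motion with Hurst index \<open>p / 2\<close>.\<close>

definition fbm_covariance :: "real \<Rightarrow> real \<Rightarrow> real \<Rightarrow> real" where
  "fbm_covariance p s u = (s powr p + u powr p - \<bar>s - u\<bar> powr p) / 2"

lemma LINT_exp_fbm_covariance:
  assumes p: "0 < p" and s: "s \<in> {0..t}"
  shows "(LINT u:{0..t}|lborel. exp u * fbm_covariance p s u) =
    (s powr p * (exp t - 1) + exp_moment p 1 t
      - exp s * (exp_moment p (- 1) s + exp_moment p 1 (t - s))) / 2"
proof (rule LINT_Icc_eq_of_has_integral)
  show "continuous_on {0..t} (\<lambda>u. exp u * fbm_covariance p s u)"
    unfolding fbm_covariance_def using p
    by (intro continuous_intros continuous_on_subset[OF continuous_on_powr_base[OF p]]) auto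
  have "((\<lambda>u. (s powr p * exp u + u powr p * exp (1 * u) - exp u * \<bar>s - u\<bar> powr p) / 2) has_integral
    (s powr p * (exp t - 1) + exp_moment p 1 t
      - exp s * (exp_moment p (- 1) s + exp_moment p 1 (t - s))) / 2) {0..t}"
    using s by (intro has_integral_divide has_integral_diff has_integral_add has_integral_mult_right
        has_integral_exp exp_moment_has_integral has_integral_exp_mult_abs_diff_powr p) auto
  then show "((\<lambda>u. exp u * fbm_covariance p s u) has_integral
    (s powr p * (exp t - 1) + exp_moment p 1 t
      - exp s * (exp_moment p (- 1) s + exp_moment p 1 (t - s))) / 2) {0..t}"
    by (rule has_integral_eq[rotated]) (simp add: fbm_covariance_def algebra_simps)
qed

text \<open>The term \<open>exp_moment p 1 (t - s)\<close> is treated after the reflection \<open>s \<mapsto> t - s\<close>. Each of the two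
  integrals is then an integration by parts, realised by the antiderivatives
  \<open>exp (2 * s) * ?A s / 2\<close> and \<open>- exp (2 * (t - s)) * ?C s / 2\<close>.\<close>

lemma has_integral_exp_moments:
  assumes p: "0 < p" and t: "0 \<le> t"
  shows "((\<lambda>s. exp (2 * s) * (exp_moment p (- 1) s + exp_moment p 1 (t - s))) has_integral
    exp (2 * t) * exp_moment p (- 1) t - exp_moment p 1 t) {0..t}"
proof -
  let ?A = "exp_moment p (- 1)" and ?C = "exp_moment p 1"
  have 1: "((\<lambda>s. exp (2 * s) * ?A s + s powr p * exp s / 2) has_integral
      exp (2 * t) * ?A t / 2 - exp (2 * 0) * ?A 0 / 2) {0..t}"
  proof (rule fundamental_theorem_of_calculus[OF t])
    fix s assume s: "s \<in> {0..t}"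
    have E: "((\<lambda>s. exp (2 * s)) has_real_derivative 2 * exp (2 * s)) (at s within {0..t})"
      by (auto intro!: derivative_eq_intros)
    have e: "exp (2 * s) * exp (- 1 * s) = exp s" by (simp flip: exp_add)
    have "((\<lambda>s. exp (2 * s) * ?A s / 2) has_real_derivative
        exp (2 * s) * ?A s + s powr p * exp s / 2) (at s within {0..t})"
      by (rule DERIV_cong[OF DERIV_cdivide[OF DERIV_mult[OF E exp_moment_has_derivative[OF p s]]]])
        (simp add: e[symmetric] add_divide_distrib)
    then show "((\<lambda>s. exp (2 * s) * ?A s / 2) has_vector_derivative
        exp (2 * s) * ?A s + s powr p * exp s / 2) (at s within {0..t})"
      by (simp only: has_real_derivative_iff_has_vector_derivative)
  qed
  have 2: "((\<lambda>s. exp (2 * (t - s)) * ?C s - exp (2 * t) * (s powr p * exp (- 1 * s)) / 2) has_integral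
      - exp (2 * (t - t)) * ?C t / 2 - (- exp (2 * (t - 0)) * ?C 0 / 2)) {0..t}"
  proof (rule fundamental_theorem_of_calculus[OF t])
    fix s assume s: "s \<in> {0..t}"
    have E: "((\<lambda>s. - exp (2 * (t - s))) has_real_derivative 2 * exp (2 * (t - s))) (at s within {0..t})"
      by (auto intro!: derivative_eq_intros)
    have e: "exp (2 * (t - s)) * exp (1 * s) = exp (2 * t) * exp (- 1 * s)" by (simp flip: exp_add)
    have "((\<lambda>s. - exp (2 * (t - s)) * ?C s / 2) has_real_derivative
        exp (2 * (t - s)) * ?C s - exp (2 * t) * (s powr p * exp (- 1 * s)) / 2) (at s within {0..t})"
      by (rule DERIV_cong[OF DERIV_cdivide[OF DERIV_mult[OF E exp_moment_has_derivative[OF p s]]]])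
        (simp add: e[symmetric] add_divide_distrib, use e in \<open>simp add: algebra_simps\<close>)
    then show "((\<lambda>s. - exp (2 * (t - s)) * ?C s / 2) has_vector_derivative
        exp (2 * (t - s)) * ?C s - exp (2 * t) * (s powr p * exp (- 1 * s)) / 2) (at s within {0..t})"
      by (simp only: has_real_derivative_iff_has_vector_derivative)
  qed
  have C: "((\<lambda>s. exp (2 * (t - s)) * ?C s) has_integral
      (- ?C t / 2) + exp (2 * t) * ?A t / 2) {0..t}"
    using has_integral_add[OF 2 has_integral_divide[OF has_integral_mult_right[OF exp_moment_has_integral[OF p, of "- 1"], of "exp (2 * t)"], of 2]]
    by simp
  have "((\<lambda>s. (exp (2 * s) * ?A s + s powr p * exp s / 2) - (s powr p * exp (1 * s)) / 2
      + exp (2 * (t - (t - s))) * ?C (t - s)) has_integral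
      (exp (2 * t) * ?A t / 2 - exp (2 * 0) * ?A 0 / 2) - ?C t / 2 + ((- ?C t / 2) + exp (2 * t) * ?A t / 2)) {0..t}"
    by (intro has_integral_add[OF has_integral_diff[OF 1]] has_integral_divide exp_moment_has_integral p has_integral_reverse[OF C])
  then show ?thesis by (simp add: algebra_simps)
qed

text \<open>The inner integral is replaced by its closed form, which is continuous in \<open>s\<close>; this is what
  allows the outer integral to be computed by antiderivatives.\<close>

lemma LINT_exp_exp_fbm_covariance:
  assumes p: "0 < p" and t: "0 \<le> t"
  shows "(LINT s:{0..t}|lborel. exp s * (LINT u:{0..t}|lborel. exp u * fbm_covariance p s u)) =
    (exp t - 1) * exp_moment p 1 t - (exp (2 * t) * exp_moment p (- 1) t - exp_moment p 1 t) / 2"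
proof -
  define h where "h s = (exp t - 1) * (s powr p * exp (1 * s)) / 2 + exp_moment p 1 t * exp s / 2
      - exp (2 * s) * (exp_moment p (- 1) s + exp_moment p 1 (t - s)) / 2" for s
  have "(LINT s:{0..t}|lborel. exp s * (LINT u:{0..t}|lborel. exp u * fbm_covariance p s u)) =
    (LINT s:{0..t}|lborel. h s)"
  proof (rule set_lebesgue_integral_cong)
    have "exp (2 * s) = exp s * exp s" for s :: real by (simp flip: exp_add)
    then show "\<forall>s. s \<in> {0..t} \<longrightarrow> exp s * (LINT u:{0..t}|lborel. exp u * fbm_covariance p s u) = h s"
      by (auto simp: LINT_exp_fbm_covariance[OF p] h_def field_simps)
  qed simp
  also have "\<dots> = (exp t - 1) * exp_moment p 1 t / 2 + exp_moment p 1 t * (exp t - 1) / 2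
      - (exp (2 * t) * exp_moment p (- 1) t - exp_moment p 1 t) / 2"
  proof (rule LINT_Icc_eq_of_has_integral)
    have "continuous_on {0..t} (\<lambda>s. exp_moment p 1 (t - s))"
      by (rule continuous_on_compose2[OF continuous_on_exp_moment[OF p, of t]]) (auto intro!: continuous_intros)
    then show "continuous_on {0..t} h" unfolding h_def[abs_def]
      by (intro continuous_intros continuous_on_exp_moment p continuous_on_subset[OF continuous_on_powr_base[OF p]]) auto
    show "(h has_integral (exp t - 1) * exp_moment p 1 t / 2 + exp_moment p 1 t * (exp t - 1) / 2
      - (exp (2 * t) * exp_moment p (- 1) t - exp_moment p 1 t) / 2) {0..t}"
      unfolding h_def[abs_def]
      by (intro has_integral_diff has_integral_add has_integral_divide has_integral_mult_right
          exp_moment_has_integral has_integral_exp has_integral_exp_moments p t)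
  qed
  finally show ?thesis by (simp add: algebra_simps)
qed

context fractional_brownian_motion
begin

lemma square_integrable:
  assumes "0 \<le> s"
  shows "B s \<in> borel_measurable M" "integrable M (\<lambda>\<omega>. (B s \<omega>)\<^sup>2)"
proof -
  have "gaussian_rv M (\<lambda>\<omega>. \<Sum>t\<in>{s}. 1 * B t \<omega>)"
    using gaussian[unfolded gaussian_process_def, rule_format, of "{s}" "\<lambda>_. 1"] assms by auto
  then have "gaussian_rv M (B s)" by simp
  from gaussian_rv_integrable_square[OF prob_space_axioms this]
  show "B s \<in> borel_measurable M" "integrable M (\<lambda>\<omega>. (B s \<omega>)\<^sup>2)" by auto
qed

lemma covariance_eq:
  assumes "0 \<le> s" "0 \<le> u" shows "expectation (\<lambda>\<omega>. B s \<omega> * B u \<omega>) = fbm_covariance (2 * H) s u"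
  using covariance[OF assms(2,1)] by (simp add: fbm_covariance_def)

lemma second_moment_eq:
  assumes "0 \<le> s" shows "expectation (\<lambda>\<omega>. (B s \<omega>)\<^sup>2) = s powr (2 * H)"
  using covariance_eq[OF assms assms] Hurst_index by (simp add: fbm_covariance_def power2_eq_square)

text \<open>Expand the square of \<open>exp t * B t - I\<close> with \<open>I = \<integral>s = 0..t. exp s * B s\<close>. The terms with
  \<open>exp (2 * t) * t powr p\<close> and with \<open>exp t * exp_moment p 1 t\<close> cancel, and what remains is the
  convolution with \<open>sinh\<close>, written in exponentials.\<close>

lemma expectation_square_wiener_integral_exp:
  assumes t: "0 \<le> t"
  shows "expectation (\<lambda>\<omega>. (wiener_integral_exp B t \<omega>)\<^sup>2) =
    exp t * sinh_transform (\<lambda>u. u powr (2 * H)) t"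
proof -
  let ?N = "restrict_space lborel {0..t}" and ?p = "2 * H"
  define I where "I \<omega> = (\<integral>s. exp s * B s \<omega> \<partial>?N)" for \<omega>
  have p: "0 < ?p" using Hurst_index by simp
  have LINT: "(\<integral>s. f s \<partial>?N) = (LINT s:{0..t}|lborel. f s)" for f :: "real \<Rightarrow> real"
    by (subst integral_restrict_space) (auto simp: set_lebesgue_integral_def)
  interpret process: square_integrable_process M ?N "\<lambda>s \<omega>. exp s * B s \<omega>" "exp (2 * t) * t powr ?p"
  proof (intro square_integrable_process.intro square_integrable_process_axioms.intro)
    show "prob_space M" by (rule prob_space_axioms)
    show "finite_measure ?N"
      by (rule finite_measureI) (simp add: emeasure_restrict_space space_restrict_space t)
    have "(\<lambda>(s, \<omega>). B (max 0 s) \<omega>) \<in> borel_measurable (borel \<Otimes>\<^sub>M M)"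
      by (intro measurable_continuous_paths square_integrable continuous_paths)
    moreover have "(\<lambda>z. (fst z, snd z)) \<in> ?N \<Otimes>\<^sub>M M \<rightarrow>\<^sub>M borel \<Otimes>\<^sub>M M"
      by (intro measurable_Pair measurable_compose[OF measurable_fst] measurable_snd measurable_restrict_space1) auto
    ultimately have [measurable]: "(\<lambda>z. B (max 0 (fst z)) (snd z)) \<in> borel_measurable (?N \<Otimes>\<^sub>M M)"
      by (auto dest: measurable_compose simp: case_prod_beta)
    have [measurable]: "(\<lambda>z. exp (fst z)) \<in> borel_measurable (?N \<Otimes>\<^sub>M M)"
      by (intro measurable_compose[OF measurable_fst] measurable_restrict_space1) auto
    have "(\<lambda>z. exp (fst z) * B (max 0 (fst z)) (snd z)) \<in> borel_measurable (?N \<Otimes>\<^sub>M M)" by measurable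
    then show "(\<lambda>(s, \<omega>). exp s * B s \<omega>) \<in> borel_measurable (?N \<Otimes>\<^sub>M M)"
      by (rule measurable_cong[THEN iffD1, rotated]) (auto simp: space_pair_measure space_restrict_space)
  next
    fix s assume "s \<in> space ?N"
    then have s: "0 \<le> s" "s \<le> t" by (auto simp: space_restrict_space)
    have square: "(exp s * B s \<omega>)\<^sup>2 = exp (2 * s) * (B s \<omega>)\<^sup>2" for \<omega>
      by (simp add: power_mult_distrib exp_double)
    show "integrable M (\<lambda>\<omega>. (exp s * B s \<omega>)\<^sup>2)"
      unfolding square by (intro integrable_mult_right square_integrable s)
    show "expectation (\<lambda>\<omega>. (exp s * B s \<omega>)\<^sup>2) \<le> exp (2 * t) * t powr ?p"
      unfolding square using s p by (simp add: second_moment_eq mult_mono powr_mono2)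
  qed
  have [measurable]: "I \<in> borel_measurable M" unfolding I_def[abs_def] by (rule process.measurable_integral)
  have I2: "integrable M (\<lambda>\<omega>. (I \<omega>)\<^sup>2)" unfolding I_def by (rule process.integrable_square_integral)
  have IB: "integrable M (\<lambda>\<omega>. I \<omega> * B t \<omega>)"
    unfolding I_def by (rule process.integrable_integral_mult) (use square_integrable t in auto)
  have "expectation (\<lambda>\<omega>. I \<omega> * B t \<omega>) = (\<integral>s. expectation (\<lambda>\<omega>. exp s * B s \<omega> * B t \<omega>) \<partial>?N)"
    unfolding I_def by (rule process.expectation_integral_mult) (use square_integrable t in auto)
  also have "\<dots> = (\<integral>s. exp s * fbm_covariance ?p t s \<partial>?N)"
    using t covariance_eq[of t] by (intro Bochner_Integration.integral_cong refl)
      (auto simp: space_restrict_space mult.assoc mult.commute[of "B _ _" "B t _"])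
  also have "\<dots> = (t powr ?p * (exp t - 1) + exp_moment ?p 1 t - exp t * exp_moment ?p (- 1) t) / 2"
    using LINT_exp_fbm_covariance[OF p, of t t] t by (simp add: LINT)
  finally have EIB: "expectation (\<lambda>\<omega>. I \<omega> * B t \<omega>) = \<dots>" .
  have "expectation (\<lambda>\<omega>. (I \<omega>)\<^sup>2) =
      (\<integral>s. \<integral>u. expectation (\<lambda>\<omega>. exp s * B s \<omega> * (exp u * B u \<omega>)) \<partial>?N \<partial>?N)"
    unfolding I_def by (rule process.expectation_square_integral)
  also have "\<dots> = (\<integral>s. exp s * (\<integral>u. exp u * fbm_covariance ?p s u \<partial>?N) \<partial>?N)"
  proof (rule Bochner_Integration.integral_cong[OF refl])
    fix s assume "s \<in> space ?N"
    then have s: "0 \<le> s" by (simp add: space_restrict_space)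
    have "expectation (\<lambda>\<omega>. exp s * B s \<omega> * (exp u * B u \<omega>)) = exp s * (exp u * fbm_covariance ?p s u)"
      if "u \<in> space ?N" for u
    proof -
      have "expectation (\<lambda>\<omega>. exp s * B s \<omega> * (exp u * B u \<omega>)) = expectation (\<lambda>\<omega>. (exp s * exp u) * (B s \<omega> * B u \<omega>))"
        by (simp add: ac_simps)
      then show ?thesis using that s by (simp add: covariance_eq space_restrict_space)
    qed
    then have "(\<integral>u. expectation (\<lambda>\<omega>. exp s * B s \<omega> * (exp u * B u \<omega>)) \<partial>?N) =
        (\<integral>u. exp s * (exp u * fbm_covariance ?p s u) \<partial>?N)"
      by (intro Bochner_Integration.integral_cong refl)
    then show "(\<integral>u. expectation (\<lambda>\<omega>. exp s * B s \<omega> * (exp u * B u \<omega>)) \<partial>?N) =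
        exp s * (\<integral>u. exp u * fbm_covariance ?p s u \<partial>?N)" by simp
  qed
  also have "\<dots> = (exp t - 1) * exp_moment ?p 1 t -
      (exp (2 * t) * exp_moment ?p (- 1) t - exp_moment ?p 1 t) / 2"
    unfolding LINT by (rule LINT_exp_exp_fbm_covariance[OF p t])
  finally have EI2: "expectation (\<lambda>\<omega>. (I \<omega>)\<^sup>2) = \<dots>" .
  have exp2: "exp (t * 2) = exp t * exp t" by (simp flip: exp_add)
  have "expectation (\<lambda>\<omega>. (wiener_integral_exp B t \<omega>)\<^sup>2) =
      expectation (\<lambda>\<omega>. exp (2 * t) * (B t \<omega>)\<^sup>2 - 2 * exp t * (I \<omega> * B t \<omega>) + (I \<omega>)\<^sup>2)"
    by (simp add: wiener_integral_exp_def I_def LINT power2_eq_square exp2 algebra_simps)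
  also have "\<dots> = exp (2 * t) * t powr ?p - 2 * exp t * expectation (\<lambda>\<omega>. I \<omega> * B t \<omega>) + expectation (\<lambda>\<omega>. (I \<omega>)\<^sup>2)"
    using I2 IB square_integrable(2)[OF t] by (simp add: second_moment_eq t)
  also have "\<dots> = exp t * sinh_transform (\<lambda>u. u powr ?p) t"
    unfolding EIB EI2 sinh_transform_def
      integral_mult_hyperbolic_conv_exp(1)[OF continuous_on_powr_base[OF p]] exp_moment_def[symmetric]
    by (simp add: exp_minus exp2 field_simps)
  finally show ?thesis .
qed

end

lemma integral_id_mult_sinh:
  fixes t :: real
  assumes "0 \<le> t" shows "integral {0..t} (\<lambda>u. u * sinh (t - u)) = sinh t - t"
proof -
  have "((\<lambda>u. u * sinh (t - u)) has_integral
      (- t * cosh (t - t) - sinh (t - t)) - (- 0 * cosh (t - 0) - sinh (t - 0))) {0..t}"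
    by (rule fundamental_theorem_of_calculus[OF assms])
       (auto simp flip: has_real_derivative_iff_has_vector_derivative intro!: derivative_eq_intros)
  then show ?thesis by (simp add: integral_unique)
qed

lemma integral_square_mult_sinh:
  fixes t :: real
  assumes "0 \<le> t" shows "integral {0..t} (\<lambda>u. u\<^sup>2 * sinh (t - u)) = 2 * cosh t - 2 - t\<^sup>2"
proof -
  have "((\<lambda>u. u\<^sup>2 * sinh (t - u)) has_integral
      (- t\<^sup>2 * cosh (t - t) - 2 * t * sinh (t - t) - 2 * cosh (t - t)) -
      (- 0\<^sup>2 * cosh (t - 0) - 2 * 0 * sinh (t - 0) - 2 * cosh (t - 0))) {0..t}"
    by (rule fundamental_theorem_of_calculus[OF assms])
       (auto simp flip: has_real_derivative_iff_has_vector_derivative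
         intro!: derivative_eq_intros simp: algebra_simps)
  then show ?thesis by (simp add: integral_unique)
qed

lemma integral_sinh_reverse:
  fixes t :: real
  assumes "0 \<le> t" shows "integral {0..t} (\<lambda>u. sinh (t - u)) = cosh t - (1::real)"
proof -
  have "((\<lambda>u. sinh (t - u)) has_integral - cosh (t - t) - (- cosh (t - 0))) {0..t}"
    by (rule fundamental_theorem_of_calculus[OF assms])
       (auto simp flip: has_real_derivative_iff_has_vector_derivative intro!: derivative_eq_intros)
  then show ?thesis by (simp add: integral_unique)
qed

lemma sinh_transform_cong:
  assumes "0 \<le> t" "\<And>u. 0 \<le> u \<Longrightarrow> \<phi> u = \<psi> u"
  shows "sinh_transform \<phi> t = sinh_transform \<psi> t"
  unfolding sinh_transform_def using assms
  by (intro arg_cong2[where f = "(+)"] integral_cong) auto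

lemma sinh_transform_powr_1:
  assumes "0 \<le> t" shows "sinh_transform (\<lambda>u. u powr 1) t = sinh t"
proof -
  have "sinh_transform (\<lambda>u. u powr 1) t = sinh_transform (\<lambda>u. u) t"
    by (rule sinh_transform_cong[OF assms]) simp
  then show ?thesis by (simp add: sinh_transform_def integral_id_mult_sinh[OF assms])
qed

lemma sinh_transform_powr_2:
  assumes "0 \<le> t" shows "sinh_transform (\<lambda>u. u powr 2) t = 2 * cosh t - 2"
proof -
  have "sinh_transform (\<lambda>u. u powr 2) t = sinh_transform (\<lambda>u. u\<^sup>2) t"
    by (rule sinh_transform_cong[OF assms]) simp
  then show ?thesis by (simp add: sinh_transform_def integral_square_mult_sinh[OF assms])
qed

lemma second_moment_at_1:
  assumes "prob_space (M 1)" "distributed (M 1) lborel \<xi> std_normal_density"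
  shows "second_moment M B \<xi> 1 t = (exp t - 1)\<^sup>2"
proof -
  interpret prob_space "M 1" by fact
  have "expectation (\<lambda>\<omega>. (\<xi> \<omega>)\<^sup>2) = 1"
    using standard_normal_distributed_variance[OF assms(2)]
    by (simp add: standard_normal_distributed_expectation[OF assms(2)])
  then show ?thesis by (simp add: second_moment_def X_process_def power_mult_distrib)
qed

text \<open>The process at \<open>H = 1\<close> is defined separately, but the closed form extends to it, because
  \<open>exp t * (2 * cosh t - 2) = (exp t - 1)\<^sup>2\<close>.\<close>

lemma second_moment_eq_sinh_transform:
  assumes fbm: "\<And>H. H \<in> {1/2..<1} \<Longrightarrow> fractional_brownian_motion (M H) H (B H)"
    and "prob_space (M 1)" "distributed (M 1) lborel \<xi> std_normal_density"
    and H: "H \<in> {1/2..1}" and t: "0 \<le> t"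
  shows "second_moment M B \<xi> H t = exp t * sinh_transform (\<lambda>u. u powr (2 * H)) t"
proof (cases "H = 1")
  case True
  have "exp t * (2 * cosh t - 2) = (exp t - 1)\<^sup>2"
    by (simp add: cosh_field_def power2_eq_square exp_minus field_simps)
  then show ?thesis using True t
    by (simp add: second_moment_at_1[where M = M, OF assms(2,3)] sinh_transform_powr_2)
next
  case False
  then interpret fractional_brownian_motion "M H" H "B H" using fbm H by auto
  show ?thesis using False t
    by (simp add: second_moment_def X_process_def expectation_square_wiener_integral_exp)
qed

section \<open>The derivative in the Hurst index\<close>

abbreviation pow_log :: "real \<Rightarrow> real \<Rightarrow> real" where
  "pow_log p u \<equiv> u powr p * ln u"

text \<open>At 0 the square root outweighs the logarithm.\<close>

lemma continuous_on_sqrt_ln: "continuous_on {0..} (\<lambda>u::real. sqrt u * ln u)"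
proof -
  have "isCont (\<lambda>u::real. sqrt u * ln u) u" if "0 < u" for u
    using that by (auto intro!: continuous_intros)
  moreover have "((\<lambda>u::real. sqrt u * ln u) \<longlongrightarrow> 0) (at_right 0)" by real_asymp
  then have "continuous (at 0 within {0..}) (\<lambda>u::real. sqrt u * ln u)"
    by (simp add: continuous_within at_within_Ici_at_right)
  ultimately show ?thesis
    unfolding continuous_on_eq_continuous_within
    using continuous_at_imp_continuous_within by (metis atLeast_iff order_le_less)
qed

text \<open>Joint continuity at \<open>u = 0\<close> uses \<open>p \<ge> 1 > 1/2\<close>: split off \<open>sqrt u * ln u\<close>, which is continuous,
  and keep the power \<open>u powr (p - 1/2)\<close> with positive exponent.\<close>

lemma continuous_on_pow_log:
  "continuous_on ({1..2} \<times> {0..}) (\<lambda>(p, u). pow_log p u)"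
proof -
  have "continuous_on ({1..2} \<times> {0..}) (\<lambda>z::real \<times> real. sqrt (snd z) * ln (snd z))"
    by (rule continuous_on_compose2[OF continuous_on_sqrt_ln continuous_on_snd[OF continuous_on_id]]) auto
  then have "continuous_on ({1..2} \<times> {0..})
    (\<lambda>z::real \<times> real. snd z powr (fst z - 1/2) * (sqrt (snd z) * ln (snd z)))"
    by (rule continuous_on_mult[rotated])
      (auto intro!: continuous_on_powr' continuous_on_diff continuous_on_snd continuous_on_fst continuous_on_id continuous_on_const)
  then show ?thesis
  proof (rule continuous_on_eq)
    fix z :: "real \<times> real" assume "z \<in> {1..2} \<times> {0..}"
    then have "0 \<le> snd z" by auto
    then have "snd z powr (fst z - 1/2) * sqrt (snd z) = snd z powr fst z"
      by (simp flip: powr_half_sqrt powr_add)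
    then show "snd z powr (fst z - 1/2) * (sqrt (snd z) * ln (snd z)) = (case z of (p, u) \<Rightarrow> pow_log p u)"
      by (simp only: case_prod_beta mult.assoc[symmetric])
  qed
qed

lemma continuous_on_pow_log_base:
  assumes "p \<in> {1..2}" shows "continuous_on {0..} (pow_log p)"
proof -
  have "continuous_on {0..} (\<lambda>u. case (p, u) of (p, u) \<Rightarrow> pow_log p u)"
    by (rule continuous_on_compose2[OF continuous_on_pow_log]) (use assms in \<open>auto intro!: continuous_intros\<close>)
  then show ?thesis by simp
qed

text \<open>The derivative of \<open>sinh_transform (\<lambda>u. u powr p) t\<close> in \<open>p\<close>. It enters through the tangent
  inequality \<open>sinh_transform_powr_tangent_less\<close>, which replaces differentiation under the integral.\<close>

definition slope :: "real \<Rightarrow> real \<Rightarrow> real" where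
  "slope p t = sinh_transform (pow_log p) t"

lemma continuous_on_slope:
  assumes "0 < t" shows "continuous_on {1..2} (\<lambda>p. slope p t)"
proof -
  have "continuous_on {1..2} (\<lambda>p. integral (cbox 0 t) (\<lambda>u. pow_log p u * sinh (t - u)))"
  proof (rule integral_continuous_on_param)
    have "continuous_on ({1..2} \<times> cbox 0 t) (\<lambda>z. (case z of (p, u) \<Rightarrow> pow_log p u) * sinh (t - snd z))"
      by (intro continuous_intros continuous_on_subset[OF continuous_on_pow_log]) auto
    then show "continuous_on ({1..2} \<times> cbox 0 t) (\<lambda>(p, u). pow_log p u * sinh (t - u))"
      by (simp add: case_prod_beta)
  qed
  then show ?thesis unfolding slope_def sinh_transform_def using assms
    by (intro continuous_intros) auto
qed

text \<open>The tangent line at 0 of the exponential function, at the point \<open>(q - p) * ln u \<noteq> 0\<close>.\<close>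

lemma powr_tangent_less:
  fixes u :: real
  assumes "0 < u" "u \<noteq> 1" "p \<noteq> q"
  shows "(q - p) * pow_log p u < u powr q - u powr p"
proof -
  have "1 + (q - p) * ln u < exp ((q - p) * ln u)"
    using assms exp_ge_add_one_self[of "(q - p) * ln u"] ln_eq_minus_one[of "exp ((q - p) * ln u)"]
    by (auto simp: order_le_less)
  then have "u powr p * (1 + (q - p) * ln u) < u powr p * exp ((q - p) * ln u)"
    using assms by simp
  also have "\<dots> = u powr q" using assms by (simp add: powr_def exp_add[symmetric] algebra_simps)
  finally show ?thesis by (simp add: algebra_simps)
qed

text \<open>Apply the positive operator to the pointwise tangent inequality. It degenerates to an equality
  at \<open>u = 0\<close> and \<open>u = 1\<close>; strictness only needs one point of \<open>[0, t)\<close> where it is strict.\<close>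

lemma sinh_transform_powr_tangent_less:
  assumes "p \<in> {1..2}" "q \<in> {1..2}" "p \<noteq> q" "0 < t"
  shows "(q - p) * slope p t < sinh_transform (\<lambda>u. u powr q) t - sinh_transform (\<lambda>u. u powr p) t"
proof -
  have c: "continuous_on {0..t} (\<lambda>u. u powr q)" "continuous_on {0..t} (\<lambda>u. u powr p)"
    using assms by (auto intro!: continuous_on_subset[OF continuous_on_powr_base])
  have c': "continuous_on {0..t} (\<lambda>u. (q - p) * pow_log p u)"
    by (intro continuous_on_mult_left continuous_on_subset[OF continuous_on_pow_log_base[OF assms(1)]]) auto
  have less: "0 < (u powr q - u powr p) - (q - p) * pow_log p u" if "0 < u" "u \<noteq> 1" for u
    using powr_tangent_less[OF that assms(3)] by simp
  have ge: "0 \<le> (u powr q - u powr p) - (q - p) * pow_log p u" if "0 \<le> u" for u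
    using that less[of u] by (cases "u = 0 \<or> u = 1") auto
  \<comment> \<open>The midpoint of \<open>[0, t]\<close> serves as the point of strictness unless it equals 1.\<close>
  define x where "x = (if t = 2 then 1/2 else t / 2)"
  have "0 < sinh_transform (\<lambda>u. (u powr q - u powr p) - (q - p) * pow_log p u) t"
    by (rule sinh_transform_pos[of _ _ x]; (intro continuous_on_diff c c' ge less)?)
      (use assms in \<open>auto simp: x_def\<close>)
  also have "\<dots> = sinh_transform (\<lambda>u. u powr q) t - sinh_transform (\<lambda>u. u powr p) t - (q - p) * slope p t"
    by (simp add: sinh_transform_diff c c' continuous_on_diff sinh_transform_cmult slope_def)
  finally show ?thesis by simp
qed

lemma pow_log_has_derivative:
  assumes "0 < u"
  shows "(pow_log p has_real_derivative u powr (p - 1) * (p * ln u + 1)) (at u)"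
    "((\<lambda>u. u powr (p - 1) * (p * ln u + 1)) has_real_derivative
        u powr (p - 2) * ((p - 1) * (p * ln u + 1) + p)) (at u)"
proof -
  have 1: "u powr p = u powr (p - 1) * u" and 2: "u powr (p - 1) = u powr (p - 2) * u"
    using assms powr_add[of u "p-1" 1] powr_add[of u "p-2" 1] by auto
  show "(pow_log p has_real_derivative u powr (p - 1) * (p * ln u + 1)) (at u)"
    using assms by (auto intro!: derivative_eq_intros simp: field_simps 1)
  show "((\<lambda>u. u powr (p - 1) * (p * ln u + 1)) has_real_derivative
        u powr (p - 2) * ((p - 1) * (p * ln u + 1) + p)) (at u)"
    using assms by (auto intro!: derivative_eq_intros simp: field_simps 2)
qed

lemma slope_neg:
  assumes "p \<in> {1..2}" "0 < t" "t \<le> 1"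
  shows "slope p t < 0"
proof -
  have "0 < sinh_transform (\<lambda>u. (-1) * pow_log p u) t"
  proof (rule sinh_transform_pos[of _ _ "t/2"])
    show "continuous_on {0..t} (\<lambda>u. (-1) * pow_log p u)"
      by (intro continuous_on_mult_left continuous_on_subset[OF continuous_on_pow_log_base[OF assms(1)]]) auto
  next
    fix u assume "u \<in> {0..t}"
    then show "0 \<le> (-1) * pow_log p u"
      using assms by (cases "u = 0") (auto simp: mult_nonneg_nonpos)
  qed (use assms in \<open>auto simp: mult_pos_neg\<close>)
  then show ?thesis unfolding sinh_transform_cmult slope_def by simp
qed

text \<open>The comparison lemma with base point 1, where the logarithm changes sign: \<open>u powr p * ln u\<close> is
  convex for \<open>u \<ge> 1\<close>, and \<open>slope p\<close> is still negative at 1.\<close>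

lemma slope_single_crossing:
  assumes "p \<in> {1..2}" "0 \<le> slope p s" "0 < s" "s < t"
  shows "0 < slope p t"
  unfolding slope_def
proof (rule sinh_transform_single_crossing[where a = 1 and s = s and
      \<phi>' = "\<lambda>u. u powr (p - 1) * (p * ln u + 1)" and
      \<phi>'' = "\<lambda>u. u powr (p - 2) * ((p - 1) * (p * ln u + 1) + p)"])
  show "sinh_transform (pow_log p) 1 < 0" using slope_neg[of p 1] assms by (simp add: slope_def)
  show "1 < s" using slope_neg[of p s] assms by force
qed (use assms in \<open>auto intro!: continuous_on_pow_log_base pow_log_has_derivative mult_nonneg_nonneg add_nonneg_nonneg simp: slope_def\<close>)

text \<open>The operator maps \<open>u - 1\<close> to \<open>sinh t - cosh t = - exp (- t)\<close>. With \<open>u * ln u \<ge> u - 1\<close> this gives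
  \<open>slope 1 t \<ge> t * ln t - (t - 1) - exp (- t)\<close>, which at \<open>t = exp 1\<close> equals \<open>1 - exp (- exp 1) > 0\<close>.\<close>

lemma slope_1_exp_1_pos: "0 < slope 1 (exp 1)"
proof -
  let ?t = "exp 1 :: real"
  have c: "continuous_on {0..?t} (pow_log 1)"
    by (rule continuous_on_subset[OF continuous_on_pow_log_base]) auto
  have ge: "0 \<le> pow_log 1 u - (u - 1)" if "0 \<le> u" for u :: real
  proof (cases "u = 0")
    case False
    then show ?thesis using that ln_le_minus_one[of "1/u"] by (simp add: ln_div field_simps)
  qed auto
  have "pow_log 1 ?t - (?t - 1) \<le> sinh_transform (\<lambda>u. pow_log 1 u - (u - 1)) ?t"
    by (rule sinh_transform_ge; (intro continuous_on_diff c continuous_intros ge)?) auto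
  also have "\<dots> = slope 1 ?t - (sinh_transform (\<lambda>u. u) ?t - sinh_transform (\<lambda>u. 1) ?t)"
    unfolding slope_def
    by (subst sinh_transform_diff; (intro c continuous_intros)?)+ simp
  also have "sinh_transform (\<lambda>u. u) ?t - sinh_transform (\<lambda>u. 1) ?t = sinh ?t - cosh ?t"
    by (simp add: sinh_transform_def integral_id_mult_sinh integral_sinh_reverse)
  also have "sinh ?t - cosh ?t = - exp (- ?t)"
    by (simp add: sinh_field_def cosh_field_def field_simps)
  finally have "1 \<le> slope 1 ?t + exp (- ?t)" by simp
  moreover have "exp (- ?t) < 1" by simp
  ultimately show ?thesis by linarith
qed

lemma continuous_on_slope_time:
  assumes "p \<in> {1..2}" "0 < s" shows "continuous_on {s..t} (slope p)"
  unfolding slope_def[abs_def] using assms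
  by (intro continuous_on_subset[OF continuous_on_sinh_transform[OF continuous_on_pow_log_base]]) auto

lemma slope_root_sign:
  assumes "p \<in> {1..2}" "slope p \<tau> = 0" "0 < t"
  shows "t < \<tau> \<Longrightarrow> slope p t < 0" "0 < \<tau> \<Longrightarrow> \<tau> < t \<Longrightarrow> 0 < slope p t"
  using slope_single_crossing[of p t \<tau>] slope_single_crossing[of p \<tau> t] assms
  by force+

section \<open>Monotonicity of functions with strict tangent lines\<close>

text \<open>Strict convexity of \<open>f\<close> on \<open>[a, b]\<close> in the form in which it is available here: \<open>g x\<close> is the
  slope of a line through \<open>(x, f x)\<close> that lies strictly below the graph elsewhere.\<close>

locale tangent_minorant =
  fixes f g :: "real \<Rightarrow> real" and a b :: real
  assumes tangent: "\<And>x y. x \<in> {a..b} \<Longrightarrow> y \<in> {a..b} \<Longrightarrow> x \<noteq> y \<Longrightarrow> (y - x) * g x < f y - f x"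
begin

lemma slope_less:
  assumes "a \<le> x" "x < y" "y \<le> b" shows "g x < g y"
proof -
  have "(y - x) * g x < (y - x) * g y"
    using tangent[of x y] tangent[of y x] assms by (auto simp: algebra_simps)
  then show ?thesis using assms by simp
qed

lemma strict_antimono_on:
  assumes "a \<le> c" "c \<le> b" "g c \<le> 0" shows "strict_antimono_on {a..c} f"
proof (rule monotone_onI)
  fix x y assume xy: "x \<in> {a..c}" "y \<in> {a..c}" "x < y"
  have "g y \<le> 0" using slope_less[of y c] xy assms by (cases "y = c") auto
  then have "0 \<le> (x - y) * g y" using xy by (intro mult_nonpos_nonpos) auto
  then show "f y < f x" using tangent[of y x] xy assms by auto
qed

lemma strict_mono_on:
  assumes "a \<le> c" "c \<le> b" "0 \<le> g c" shows "strict_mono_on {c..b} f"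
proof (rule monotone_onI)
  fix x y assume xy: "x \<in> {c..b}" "y \<in> {c..b}" "x < y"
  have "0 \<le> g x" using slope_less[of c x] xy assms by (cases "x = c") auto
  then have "0 \<le> (y - x) * g x" using xy by simp
  then show "f x < f y" using tangent[of x y] xy assms by auto
qed

lemma valley:
  assumes "continuous_on {a..b} g" "a \<le> b" "g a < 0" "0 < g b"
  obtains c where "a < c" "c < b" "strict_antimono_on {a..c} f" "strict_mono_on {c..b} f"
proof -
  obtain c where c: "a \<le> c" "c \<le> b" "g c = 0"
    using IVT'[of g a 0 b] assms by force
  moreover have "a \<noteq> c" "c \<noteq> b" using c assms by auto
  ultimately show thesis using that strict_antimono_on strict_mono_on by force
qed

end

section \<open>Behaviour of the second moment in the Hurst index\<close>

theorem theorem3p2: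
  fixes M :: "real \<Rightarrow> 'a measure"
    and B :: "real \<Rightarrow> real \<Rightarrow> 'a \<Rightarrow> real"
    and \<xi> :: "'a \<Rightarrow> real"
    and V :: "real \<Rightarrow> real \<Rightarrow> real"
  defines "V \<equiv> second_moment M B \<xi>"
  assumes fbm: "\<And>H. H \<in> {1/2..<1} \<Longrightarrow> fractional_brownian_motion (M H) H (B H)"
    and prob: "prob_space (M 1)"
    and normal: "distributed (M 1) lborel \<xi> std_normal_density"
  shows "\<exists>\<tau>\<^sub>h \<tau>\<^sub>1 :: real. \<tau>\<^sub>h > ln 3 \<and> ln 3 > \<tau>\<^sub>1 \<and> \<tau>\<^sub>1 > 1 \<and>
    (\<forall>t\<in>{0<..\<tau>\<^sub>1}. strict_antimono_on {1/2..1} (\<lambda>H. V H t)) \<and>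
    (\<forall>t\<in>{\<tau>\<^sub>1<..<ln 3}. \<exists>H\<^sub>t. 1/2 < H\<^sub>t \<and> H\<^sub>t < 1 \<and>
       strict_antimono_on {1/2..H\<^sub>t} (\<lambda>H. V H t) \<and>
       strict_mono_on {H\<^sub>t..1} (\<lambda>H. V H t) \<and>
       V 1 t < V (1/2) t) \<and>
    (\<exists>H\<^sub>t. 1/2 < H\<^sub>t \<and> H\<^sub>t < 1 \<and>
       strict_antimono_on {1/2..H\<^sub>t} (\<lambda>H. V H (ln 3)) \<and>
       strict_mono_on {H\<^sub>t..1} (\<lambda>H. V H (ln 3)) \<and>
       V (1/2) (ln 3) = V 1 (ln 3)) \<and>
    (\<forall>t\<in>{ln 3<..\<tau>\<^sub>h}. \<exists>H\<^sub>t. 1/2 \<le> H\<^sub>t \<and> H\<^sub>t < 1 \<and>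
       strict_antimono_on {1/2..H\<^sub>t} (\<lambda>H. V H t) \<and>
       strict_mono_on {H\<^sub>t..1} (\<lambda>H. V H t) \<and>
       V (1/2) t < V 1 t) \<and>
    (\<forall>t>\<tau>\<^sub>h. strict_mono_on {1/2..1} (\<lambda>H. V H t))"
proof -
  have V: "V H t = exp t * sinh_transform (\<lambda>u. u powr (2 * H)) t"
    if "H \<in> {1/2..1}" "0 \<le> t" for H t
    unfolding V_def using fbm prob normal that by (rule second_moment_eq_sinh_transform)
  define g where "g t H = 2 * exp t * slope (2 * H) t" for t H
  have tangent: "tangent_minorant (\<lambda>H. V H t) (g t) (1/2) 1" if t: "0 < t" for t
  proof
    fix H K :: real assume HK: "H \<in> {1/2..1}" "K \<in> {1/2..1}" "H \<noteq> K"
    have "exp t * ((2 * K - 2 * H) * slope (2 * H) t) < exp t *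
        (sinh_transform (\<lambda>u. u powr (2 * K)) t - sinh_transform (\<lambda>u. u powr (2 * H)) t)"
      using HK t by (intro mult_strict_left_mono sinh_transform_powr_tangent_less) auto
    then show "(K - H) * g t H < V K t - V H t"
      using HK t by (simp add: V g_def algebra_simps)
  qed
  have cont_g: "continuous_on {1/2..1} (g t)" if "0 < t" for t
    unfolding g_def[abs_def]
    by (intro continuous_intros continuous_on_compose2[OF continuous_on_slope[OF that]]) auto
  have g_sign: "g t (1/2) < 0 \<longleftrightarrow> slope 1 t < 0" "0 < g t 1 \<longleftrightarrow> 0 < slope 2 t"
    "0 \<le> g t (1/2) \<longleftrightarrow> 0 \<le> slope 1 t" "g t 1 \<le> 0 \<longleftrightarrow> slope 2 t \<le> 0" for t
    by (simp_all add: g_def mult_less_0_iff zero_less_mult_iff zero_le_mult_iff mult_le_0_iff)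
  have V_diff: "V 1 t - V (1/2) t = (exp t - 1) * (exp t - 3) / 2" if "0 \<le> t" for t
  proof -
    have "V (1/2) t = exp t * sinh_transform (\<lambda>u. u powr 1) t" using V[of "1/2" t] that by simp
    moreover have "V 1 t = exp t * sinh_transform (\<lambda>u. u powr 2) t" using V[of 1 t] that by simp
    ultimately have "V 1 t - V (1/2) t = exp t * (2 * cosh t - 2 - sinh t)"
      unfolding sinh_transform_powr_1[OF that] sinh_transform_powr_2[OF that] by (simp add: algebra_simps)
    also have "\<dots> = (exp t - 1) * (exp t - 3) / 2"
      by (simp add: cosh_field_def sinh_field_def exp_minus field_simps)
    finally show ?thesis .
  qed
  have ln3: "0 < ln (3::real)" by simp
  interpret ln3: tangent_minorant "\<lambda>H. V H (ln 3)" "g (ln 3)" "1/2" 1 by (rule tangent[OF ln3])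
  have V_ln3: "V (1/2) (ln 3) = V 1 (ln 3)" using V_diff[of "ln 3"] by simp
  \<comment> \<open>The tangent lines at the two ends of \<open>[1/2, 1]\<close>, evaluated at the opposite ends, where the
  function has the same value.\<close>
  have slope_ln3: "slope 1 (ln 3) < 0" "0 < slope 2 (ln 3)"
    using ln3.tangent[of "1/2" 1] ln3.tangent[of 1 "1/2"] V_ln3 g_sign[of "ln 3"] by auto
  \<comment> \<open>The bound \<open>exp 1 < 3\<close> is not computed: \<open>slope 2\<close> is negative up to 1 but positive at \<open>ln 3\<close>.\<close>
  have ln3_gt_1: "1 < ln (3::real)"
    using slope_neg[of 2 "ln 3"] slope_ln3 by force
  obtain \<tau>\<^sub>1 where \<tau>1: "1 \<le> \<tau>\<^sub>1" "\<tau>\<^sub>1 \<le> ln 3" "slope 2 \<tau>\<^sub>1 = 0"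
    using IVT'[of "slope 2" 1 0 "ln 3"] slope_neg[of 2 1] slope_ln3 ln3_gt_1
      continuous_on_slope_time[of 2 1 "ln 3"] by auto
  \<comment> \<open>Both \<open>ln 3 \<le> 2\<close> and \<open>2 \<le> exp 1\<close> are instances of \<open>1 + x \<le> exp x\<close>.\<close>
  have "ln 3 \<le> exp (1::real)"
    using ln_le_minus_one[of "3::real"] exp_ge_add_one_self[of "1::real"] by linarith
  then obtain \<tau>\<^sub>h where \<tau>h: "ln 3 \<le> \<tau>\<^sub>h" "slope 1 \<tau>\<^sub>h = 0"
    using IVT'[of "slope 1" "ln 3" 0 "exp 1"] slope_1_exp_1_pos slope_ln3
      continuous_on_slope_time[of 1 "ln 3" "exp 1"] by force
  have \<tau>1_gt: "1 < \<tau>\<^sub>1" using \<tau>1 slope_neg[of 2 1] by (cases "\<tau>\<^sub>1 = 1") auto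
  have \<tau>1_lt: "\<tau>\<^sub>1 < ln 3" using \<tau>1 slope_ln3 by (cases "\<tau>\<^sub>1 = ln 3") auto
  have \<tau>h_gt: "ln 3 < \<tau>\<^sub>h" using \<tau>h slope_ln3 by (cases "\<tau>\<^sub>h = ln 3") auto
  have valley: "\<exists>c. 1/2 < c \<and> c < 1 \<and> strict_antimono_on {1/2..c} (\<lambda>H. V H t) \<and>
      strict_mono_on {c..1} (\<lambda>H. V H t)" if t: "\<tau>\<^sub>1 < t" "t < \<tau>\<^sub>h" for t
  proof -
    have pos: "0 < t" using t \<tau>1 by simp
    interpret t: tangent_minorant "\<lambda>H. V H t" "g t" "1/2" 1 by (rule tangent[OF pos])
    have "slope 1 t < 0" by (rule slope_root_sign(1)[of 1 \<tau>\<^sub>h]) (use \<tau>h t pos in auto)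
    moreover have "0 < slope 2 t" by (rule slope_root_sign(2)[of 2 \<tau>\<^sub>1]) (use \<tau>1 t pos in auto)
    ultimately have "g t (1/2) < 0" "0 < g t 1" using g_sign[of t] by auto
    then show ?thesis using t.valley[OF cont_g[OF pos]] by fastforce
  qed
  have decreasing: "strict_antimono_on {1/2..1} (\<lambda>H. V H t)" if "0 < t" "t \<le> \<tau>\<^sub>1" for t
  proof -
    interpret t: tangent_minorant "\<lambda>H. V H t" "g t" "1/2" 1 by (rule tangent[OF that(1)])
    have "slope 2 t \<le> 0" using slope_root_sign(1)[of 2 \<tau>\<^sub>1 t] \<tau>1 that by (cases "t = \<tau>\<^sub>1") auto
    then show ?thesis using t.strict_antimono_on[of 1] g_sign[of t] by simp
  qed
  have increasing: "strict_mono_on {1/2..1} (\<lambda>H. V H t)" if "\<tau>\<^sub>h \<le> t" for t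
  proof -
    have pos: "0 < t" using that \<tau>h_gt ln3 by linarith
    interpret t: tangent_minorant "\<lambda>H. V H t" "g t" "1/2" 1 by (rule tangent[OF pos])
    have "0 \<le> slope 1 t"
      using slope_root_sign(2)[of 1 \<tau>\<^sub>h t] \<tau>h \<tau>h_gt ln3 pos that by (cases "t = \<tau>\<^sub>h") auto
    then show ?thesis using t.strict_mono_on[of "1/2"] g_sign[of t] by simp
  qed
  have V_less: "V 1 t < V (1/2) t" if "0 < t" "t < ln 3" for t
  proof -
    have "exp t < 3" using that(2) exp_less_mono[of t "ln 3"] by simp
    then have "(exp t - 1) * (exp t - 3) / 2 < 0" using that(1) by (simp add: mult_pos_neg)
    then have "V 1 t - V (1/2) t < 0" using V_diff[of t] that by linarith
    then show ?thesis by simp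
  qed
  have V_greater: "V (1/2) t < V 1 t" if "ln 3 < t" for t
  proof -
    have "3 < exp t" using that exp_less_mono[of "ln 3" t] by simp
    then have "0 < (exp t - 1) * (exp t - 3) / 2" by (intro divide_pos_pos mult_pos_pos; linarith)
    then have "0 < V 1 t - V (1/2) t" using V_diff[of t] that ln3 by linarith
    then show ?thesis by simp
  qed
  have d: "\<exists>H\<^sub>t. 1/2 \<le> H\<^sub>t \<and> H\<^sub>t < 1 \<and> strict_antimono_on {1/2..H\<^sub>t} (\<lambda>H. V H t) \<and>
       strict_mono_on {H\<^sub>t..1} (\<lambda>H. V H t) \<and> V (1/2) t < V 1 t"
    if t: "ln 3 < t" "t \<le> \<tau>\<^sub>h" for t
  proof (cases "t = \<tau>\<^sub>h")
    case True
    \<comment> \<open>At \<open>t = \<tau>\<^sub>h\<close> the minimum sits at the left end \<open>1/2\<close>, and the decreasing branch is a single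
    point.\<close>
    then show ?thesis using increasing[of t] V_greater[OF t(1)]
      by (intro exI[of _ "1/2"]) (auto simp: monotone_on_def)
  next
    case False
    then have "\<tau>\<^sub>1 < t" "t < \<tau>\<^sub>h" using t \<tau>1_lt by auto
    then obtain c where "1/2 < c" "c < 1" "strict_antimono_on {1/2..c} (\<lambda>H. V H t)"
        "strict_mono_on {c..1} (\<lambda>H. V H t)"
      using valley by blast
    then show ?thesis using V_greater[OF t(1)] by (intro exI[of _ c]) auto
  qed
  show ?thesis
  proof (rule exI[of _ \<tau>\<^sub>h], rule exI[of _ \<tau>\<^sub>1], intro conjI ballI allI impI)
    show "\<exists>H\<^sub>t. 1/2 < H\<^sub>t \<and> H\<^sub>t < 1 \<and> strict_antimono_on {1/2..H\<^sub>t} (\<lambda>H. V H t) \<and>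
       strict_mono_on {H\<^sub>t..1} (\<lambda>H. V H t) \<and> V 1 t < V (1/2) t" if "t \<in> {\<tau>\<^sub>1<..<ln 3}" for t
      using valley[of t] V_less[of t] that \<tau>1 \<tau>h_gt by auto
    show "\<exists>H\<^sub>t. 1/2 < H\<^sub>t \<and> H\<^sub>t < 1 \<and> strict_antimono_on {1/2..H\<^sub>t} (\<lambda>H. V H (ln 3)) \<and>
       strict_mono_on {H\<^sub>t..1} (\<lambda>H. V H (ln 3)) \<and> V (1/2) (ln 3) = V 1 (ln 3)"
      using valley[of "ln 3"] V_ln3 \<tau>1_lt \<tau>h_gt by auto
  qed (use decreasing increasing d \<tau>1_gt \<tau>1_lt \<tau>h_gt in auto)
qed

end
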